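(* Let $Q$ be a commutative Noetherian monoid and let $\sim$ be any congruence on $Q$. Then $\sim$ is the common refinement (intersection of equivalence relations) of the soccular components $\overline{\sim}_w^P$, where $P$ ranges over all monoid primes of $Q$ and $w$ ranges over all key $\sim$-witnesses for $P$.
   Context: Monoids. $Q$ is commutative, Noetherian (equivalently finitely generated), written additively. A congruence on $Q$ is an equivalence relation $\sim$ with $a\sim b\Rightarrow a+c\sim b+c$. An ideal of a monoid is a subset closed under adding arbitrary elements; $\langle q\rangle$ is the ideal generated by $q$. A nil is an absorbing element $\infty$; an element is nilpotent if some positive multiple is nil; $c$ is cancellative if $a+c=b+c\Rightarrow a=b$. A prime $P\subset Q$ is a proper, possibly empty, ideal whose complement is a submonoid. $Q_P$ is the localization inverting $Q\smallsetminus P$; $\sim$ generates a congruence on $Q_P$, also written $\sim$; $\overline Q=Q/{\sim}$, $\overline Q_P=Q_P/{\sim}$, and $\bar q$ is the image of $q\in Q$ in $\overline Q_P$. Green's preorder: $a\le b$ iff $\langle b\rangle\subseteq\langle a\rangle$; two elements are Green's equivalent if they generate the same ideal. Witnesses. For a congruence $\sim$ and a prime $P$: $q\in Q$ is a key aide for $w\in Q$ if $\bar w\neq\bar q$, $\bar w+\bar p=\bar q+\bar p$ for all $p\in P$, and $\bar q$ is maximal in $\{\bar q,\bar w\}$ (i.e. not $\bar q<\bar w$ strictly in Green's preorder). $w$ is a key ($\sim$-)witness for $P$ if it has a key aide. A key witness $w$ is a cogenerator of $\sim$ if $w+p$ is nil modulo $\sim$ for all $p\in P$. Congruences. $\sim$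 is $P$-primary if every $p\in P$ is nilpotent in $\overline Q$ and every $f\in Q\smallsetminus P$ is cancellative in $\overline Q$; it is mesoprimary if moreover every $q\in\overline Q$ is partly cancellative, i.e. $q+a=q+b\neq\infty\Rightarrow a=b$ for all cancellative $a,b\in\overline Q$; it is ($P$-)coprincipal if it is mesoprimary and all its cogenerators generate the same ideal in $\overline Q_P$. Coprincipal component. For a key witness $w$ for $P$, $\sim_w^P$ relates $a,b\in Q$ iff (a) neither $\langle\bar a\rangle$ nor $\langle\bar b\rangle$ contains $\bar w$ in $\overline Q_P$; or (b) $\bar a,\bar b$ differ by a unit of $\overline Q_P$ and $\bar a+\bar c=\bar b+\bar c=\bar w$ for some $\bar c\in\overline Q_P$. It is a $P$-coprincipal congruence with cogenerator $w$. Soccular collapse. For a $P$-coprincipal congruence $\sim$ with cogenerator $w$, its (first) soccular collapse $\approx$ is: $a\approx b$ iff $a\sim b$, or $\bar a,\bar b\notin\langle\bar w\rangle\subseteq\overline Q_P$ and $a+p\sim b+p$ for all $p\in P$. The $i$-th collapse is the collapse of the $(i-1)$-st. (Each collapse is again $P$-coprincipal with cogenerator $w$.) The soccular closure of $\sim$ relates $a,b$ iff they are related under some iterated collapse. For an arbitrary congruence $\sim$, the soccular component $\overline{\sim}_w^P$ cogenerated by $w$ along $P$ is the soccular closure of the coprincipal component $\sim_w^P$. The empty common refinement is the universal congruence. *)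

theory Defs
  imports "HOL-Algebra.Group"
begin

text \<open>
  Commutative monoids are the \<^locale>\<open>comm_monoid\<close> structures of HOL-Algebra, so the
  additive \<open>a + b\<close>, \<open>0\<close> of the mathematical text are written \<open>a \<otimes> b\<close>, \<open>\<one>\<close>.
\<close>

definition monoid_congruence :: "('a, 'b) monoid_scheme \<Rightarrow> 'a rel \<Rightarrow> bool" where
  "monoid_congruence M r \<longleftrightarrow> equiv (carrier M) r \<and>
     (\<forall>a b c. (a, b) \<in> r \<longrightarrow> c \<in> carrier M \<longrightarrow> (a \<otimes>\<^bsub>M\<^esub> c, b \<otimes>\<^bsub>M\<^esub> c) \<in> r)"

text \<open>
  Noetherian means the ascending chain condition on congruences; for commutative monoids
  this is equivalent to finite generation (Redei, Budach).
\<close>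

definition noetherian_comm_monoid :: "('a, 'b) monoid_scheme \<Rightarrow> bool" where
  "noetherian_comm_monoid M \<longleftrightarrow> comm_monoid M \<and>
     (\<forall>c :: nat \<Rightarrow> 'a rel. (\<forall>i. monoid_congruence M (c i) \<and> c i \<subseteq> c (Suc i)) \<longrightarrow>
        (\<exists>n. \<forall>i\<ge>n. c i = c n))"

definition generated_congruence :: "('a, 'b) monoid_scheme \<Rightarrow> 'a rel \<Rightarrow> 'a rel" where
  "generated_congruence M S = \<Inter>{r. monoid_congruence M r \<and> S \<subseteq> r}"

definition quotient_monoid :: "('a, 'b) monoid_scheme \<Rightarrow> 'a rel \<Rightarrow> 'a set monoid" where
  "quotient_monoid M r =
     \<lparr>carrier = carrier M // r,
      mult = (\<lambda>A B. \<Union>a\<in>A. \<Union>b\<in>B. r `` {a \<otimes>\<^bsub>M\<^esub> b}),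
      one = r `` {\<one>\<^bsub>M\<^esub>}\<rparr>"

definition monoid_ideal :: "('a, 'b) monoid_scheme \<Rightarrow> 'a set \<Rightarrow> bool" where
  "monoid_ideal M I \<longleftrightarrow> I \<subseteq> carrier M \<and> (\<forall>a\<in>I. \<forall>c\<in>carrier M. a \<otimes>\<^bsub>M\<^esub> c \<in> I)"

definition generated_ideal :: "('a, 'b) monoid_scheme \<Rightarrow> 'a \<Rightarrow> 'a set" where
  "generated_ideal M q = \<Inter>{I. monoid_ideal M I \<and> q \<in> I}"

definition monoid_prime :: "('a, 'b) monoid_scheme \<Rightarrow> 'a set \<Rightarrow> bool" where
  "monoid_prime M P \<longleftrightarrow> monoid_ideal M P \<and> P \<noteq> carrier M \<and> submonoid (carrier M - P) M"

definition green_le :: "('a, 'b) monoid_scheme \<Rightarrow> 'a \<Rightarrow> 'a \<Rightarrow> bool" where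
  "green_le M a b \<longleftrightarrow> generated_ideal M b \<subseteq> generated_ideal M a"

definition green_less :: "('a, 'b) monoid_scheme \<Rightarrow> 'a \<Rightarrow> 'a \<Rightarrow> bool" where
  "green_less M a b \<longleftrightarrow> green_le M a b \<and> \<not> green_le M b a"

text \<open>
  The localization \<open>Q\<^sub>P\<close> is the monoid of fractions \<open>a / s\<close> with \<open>s \<notin> P\<close>, realized as a
  quotient of the product monoid \<open>Q \<times> (Q - P)\<close>.
\<close>

definition fraction_rel :: "('a, 'b) monoid_scheme \<Rightarrow> 'a set \<Rightarrow> ('a \<times> 'a) rel" where
  "fraction_rel Q P =
     {((a, s), (b, t)) | a s b t.
        a \<in> carrier Q \<and> b \<in> carrier Q \<and> s \<in> carrier Q - P \<and> t \<in> carrier Q - P \<and>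
        (\<exists>u \<in> carrier Q - P. u \<otimes>\<^bsub>Q\<^esub> (a \<otimes>\<^bsub>Q\<^esub> t) = u \<otimes>\<^bsub>Q\<^esub> (b \<otimes>\<^bsub>Q\<^esub> s))}"

definition localization :: "('a, 'b) monoid_scheme \<Rightarrow> 'a set \<Rightarrow> ('a \<times> 'a) set monoid" where
  "localization Q P =
     quotient_monoid (Q \<times>\<times> Q\<lparr>carrier := carrier Q - P\<rparr>) (fraction_rel Q P)"

definition to_localization :: "('a, 'b) monoid_scheme \<Rightarrow> 'a set \<Rightarrow> 'a \<Rightarrow> ('a \<times> 'a) set" where
  "to_localization Q P a = fraction_rel Q P `` {(a, \<one>\<^bsub>Q\<^esub>)}"

definition localized_congruence ::
  "('a, 'b) monoid_scheme \<Rightarrow> 'a rel \<Rightarrow> 'a set \<Rightarrow> ('a \<times> 'a) set rel" where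
  "localized_congruence Q r P =
     generated_congruence (localization Q P)
       {(to_localization Q P a, to_localization Q P b) | a b. (a, b) \<in> r}"

text \<open>\<open>local_quotient Q r P\<close> is the quotient of \<open>Q\<^sub>P\<close> by (the congruence generated by) \<open>r\<close>,
  and \<open>local_class Q r P q\<close> is the image in it of \<open>q \<in> Q\<close>.\<close>

definition local_quotient ::
  "('a, 'b) monoid_scheme \<Rightarrow> 'a rel \<Rightarrow> 'a set \<Rightarrow> ('a \<times> 'a) set set monoid" where
  "local_quotient Q r P = quotient_monoid (localization Q P) (localized_congruence Q r P)"

definition local_class ::
  "('a, 'b) monoid_scheme \<Rightarrow> 'a rel \<Rightarrow> 'a set \<Rightarrow> 'a \<Rightarrow> ('a \<times> 'a) set set" where
  "local_class Q r P q = localized_congruence Q r P `` {to_localization Q P q}"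

definition key_aide ::
  "('a, 'b) monoid_scheme \<Rightarrow> 'a rel \<Rightarrow> 'a set \<Rightarrow> 'a \<Rightarrow> 'a \<Rightarrow> bool" where
  "key_aide Q r P w q \<longleftrightarrow>
     (let L = local_quotient Q r P; \<beta> = local_class Q r P
      in q \<in> carrier Q \<and> \<beta> w \<noteq> \<beta> q \<and>
         (\<forall>p\<in>P. \<beta> w \<otimes>\<^bsub>L\<^esub> \<beta> p = \<beta> q \<otimes>\<^bsub>L\<^esub> \<beta> p) \<and>
         \<not> green_less L (\<beta> q) (\<beta> w))"

definition key_witness :: "('a, 'b) monoid_scheme \<Rightarrow> 'a rel \<Rightarrow> 'a set \<Rightarrow> 'a \<Rightarrow> bool" where
  "key_witness Q r P w \<longleftrightarrow> w \<in> carrier Q \<and> (\<exists>q. key_aide Q r P w q)"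

definition coprincipal_component ::
  "('a, 'b) monoid_scheme \<Rightarrow> 'a rel \<Rightarrow> 'a set \<Rightarrow> 'a \<Rightarrow> 'a rel" where
  "coprincipal_component Q r P w =
     (let L = local_quotient Q r P; \<beta> = local_class Q r P
      in {(a, b). a \<in> carrier Q \<and> b \<in> carrier Q \<and>
           (\<beta> w \<notin> generated_ideal L (\<beta> a) \<and> \<beta> w \<notin> generated_ideal L (\<beta> b) \<or>
            (\<exists>u\<in>Units L. \<beta> b = \<beta> a \<otimes>\<^bsub>L\<^esub> u) \<and>
            (\<exists>c\<in>carrier L. \<beta> a \<otimes>\<^bsub>L\<^esub> c = \<beta> w \<and> \<beta> b \<otimes>\<^bsub>L\<^esub> c = \<beta> w))})"

text \<open>
  The bars in the soccular collapse refer to the congruence \<open>r\<close> being collapsed, so along the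
  iteration in \<open>soccular_closure\<close> they change from step to step. The collapse is only of
  interest when \<open>r\<close> is \<open>P\<close>-coprincipal with cogenerator \<open>w\<close>.
\<close>

definition soccular_collapse ::
  "('a, 'b) monoid_scheme \<Rightarrow> 'a set \<Rightarrow> 'a \<Rightarrow> 'a rel \<Rightarrow> 'a rel" where
  "soccular_collapse Q P w r =
     (let L = local_quotient Q r P; \<beta> = local_class Q r P
      in {(a, b). a \<in> carrier Q \<and> b \<in> carrier Q \<and>
           ((a, b) \<in> r \<or>
            \<beta> a \<notin> generated_ideal L (\<beta> w) \<and> \<beta> b \<notin> generated_ideal L (\<beta> w) \<and>
            (\<forall>p\<in>P. (a \<otimes>\<^bsub>Q\<^esub> p, b \<otimes>\<^bsub>Q\<^esub> p) \<in> r))})"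

definition soccular_closure ::
  "('a, 'b) monoid_scheme \<Rightarrow> 'a set \<Rightarrow> 'a \<Rightarrow> 'a rel \<Rightarrow> 'a rel" where
  "soccular_closure Q P w r = (\<Union>i. (soccular_collapse Q P w ^^ i) r)"

definition soccular_component ::
  "('a, 'b) monoid_scheme \<Rightarrow> 'a rel \<Rightarrow> 'a set \<Rightarrow> 'a \<Rightarrow> 'a rel" where
  "soccular_component Q r P w = soccular_closure Q P w (coprincipal_component Q r P w)"

text \<open>Intersecting inside \<open>carrier Q \<times> carrier Q\<close> makes the empty common refinement the
  universal congruence on \<open>Q\<close>.\<close>

definition common_refinement :: "('a, 'b) monoid_scheme \<Rightarrow> 'a rel set \<Rightarrow> 'a rel" where
  "common_refinement Q R = {(a, b). a \<in> carrier Q \<and> b \<in> carrier Q \<and> (\<forall>s\<in>R. (a, b) \<in> s)}"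

end

theory Submission
  imports Defs
begin

text \<open>
  If \<open>a\<close> and \<open>b\<close> are not congruent, the transporters \<open>{p. a + q + p \<sim> b + q + p}\<close> are
  ideals, and one that is maximal among the proper ones is a prime \<open>P\<close>. Then \<open>a + q\<close> and
  \<open>b + q\<close> stay distinct in the localization at \<open>P\<close> but are identified by every \<open>p \<in> P\<close>, so
  one of them is a key witness \<open>w\<close> for \<open>P\<close> whose aide is the other. They are not related
  under the coprincipal component, and no soccular collapse can relate them, because it only
  adds pairs outside \<open>\<langle>w\<rangle>\<close>. As the collapses are stable under translation, \<open>a\<close> and \<open>b\<close> are
  separated as well.
\<close>

section \<open>Quotients by congruences\<close>

lemma monoid_congruenceD:
  assumes "monoid_congruence M r"
  shows "equiv (carrier M) r"
    and "(a, b) \<in> r \<Longrightarrow> c \<in> carrier M \<Longrightarrow> (a \<otimes>\<^bsub>M\<^esub> c, b \<otimes>\<^bsub>M\<^esub> c) \<in> r"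
    and "(a, b) \<in> r \<Longrightarrow> a \<in> carrier M \<and> b \<in> carrier M"
    and "a \<in> carrier M \<Longrightarrow> (a, a) \<in> r"
    and "(a, b) \<in> r \<Longrightarrow> (b, a) \<in> r"
    and "(a, b) \<in> r \<Longrightarrow> (b, c) \<in> r \<Longrightarrow> (a, c) \<in> r"
  using assms unfolding monoid_congruence_def equiv_def refl_on_def
  by (auto dest: symD transD)

lemma monoid_congruenceI:
  assumes "r \<subseteq> carrier M \<times> carrier M"
    and "\<And>a. a \<in> carrier M \<Longrightarrow> (a, a) \<in> r"
    and "\<And>a b. (a, b) \<in> r \<Longrightarrow> (b, a) \<in> r"
    and "\<And>a b c. (a, b) \<in> r \<Longrightarrow> (b, c) \<in> r \<Longrightarrow> (a, c) \<in> r"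
    and "\<And>a b c. (a, b) \<in> r \<Longrightarrow> c \<in> carrier M \<Longrightarrow> (a \<otimes>\<^bsub>M\<^esub> c, b \<otimes>\<^bsub>M\<^esub> c) \<in> r"
  shows "monoid_congruence M r"
  using assms unfolding monoid_congruence_def equiv_def refl_on_def sym_def trans_def
  by blast

lemma class_eq_iff:
  assumes "monoid_congruence M r" "a \<in> carrier M" "b \<in> carrier M"
  shows "r `` {a} = r `` {b} \<longleftrightarrow> (a, b) \<in> r"
  by (meson assms eq_equiv_class_iff monoid_congruenceD(1))

context comm_monoid
begin

text \<open>Commuting \<open>u\<close> past \<open>d\<close> gives
  \<open>w \<otimes> u = a \<otimes> u \<otimes> d\<close>. Applied to the unit in the second clause
  of the coprincipal component, it shows that this unit fixes the image of the cogenerator.\<close>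

lemma common_multiple_fixed:
  assumes "a \<in> carrier G" "u \<in> carrier G" "d \<in> carrier G"
    and "a \<otimes> d = w" "a \<otimes> u \<otimes> d = w"
  shows "w \<otimes> u = w"
proof -
  have "a \<otimes> d \<otimes> u = a \<otimes> u \<otimes> d"
    using assms(1-3) by (simp add: m_ac)
  then show ?thesis
    using assms by simp
qed

lemma congruence_mult:
  assumes r: "monoid_congruence G r" and "(a, a') \<in> r" "(b, b') \<in> r"
  shows "(a \<otimes> b, a' \<otimes> b') \<in> r"
proof -
  have c: "a \<in> carrier G" "a' \<in> carrier G" "b \<in> carrier G" "b' \<in> carrier G"
    using assms monoid_congruenceD(3)[OF r] by blast+
  have "(a \<otimes> b, a' \<otimes> b) \<in> r"
    using monoid_congruenceD(2)[OF r] assms c by blast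
  moreover have "(b \<otimes> a', b' \<otimes> a') \<in> r"
    using monoid_congruenceD(2)[OF r] assms c by blast
  ultimately show ?thesis
    using monoid_congruenceD(6)[OF r] m_comm c by metis
qed

text \<open>The product in \<open>quotient_monoid\<close> is a union over all representatives.
  Compatibility with multiplication makes the family constant, and both classes are nonempty, so the
  union is a single class.\<close>

lemma quotient_mult:
  assumes r: "monoid_congruence G r" and c: "a \<in> carrier G" "b \<in> carrier G"
  shows "r `` {a} \<otimes>\<^bsub>quotient_monoid G r\<^esub> r `` {b} = r `` {a \<otimes> b}"
proof -
  have "r `` {x \<otimes> y} = r `` {a \<otimes> b}" if "x \<in> r `` {a}" "y \<in> r `` {b}" for x y
  proof -
    have xy: "(a \<otimes> b, x \<otimes> y) \<in> r"
      using congruence_mult[OF r] that by blast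
    then show ?thesis
      using equiv_class_eq[OF monoid_congruenceD(1)[OF r] xy] by simp
  qed
  then have "(\<Union>x\<in>r `` {a}. \<Union>y\<in>r `` {b}. r `` {x \<otimes> y}) =
      (\<Union>x\<in>r `` {a}. \<Union>y\<in>r `` {b}. r `` {a \<otimes> b})"
    by (intro SUP_cong refl)
  moreover have "r `` {a} \<noteq> {}" "r `` {b} \<noteq> {}"
    using monoid_congruenceD(4)[OF r] c by blast+
  ultimately show ?thesis
    unfolding quotient_monoid_def by simp
qed

lemma quotient_carrier: "carrier (quotient_monoid G r) = (\<lambda>a. r `` {a}) ` carrier G"
  unfolding quotient_monoid_def quotient_def by auto

lemma quotient_one: "\<one>\<^bsub>quotient_monoid G r\<^esub> = r `` {\<one>}"
  unfolding quotient_monoid_def by simp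

lemma comm_monoid_quotient:
  assumes r: "monoid_congruence G r"
  shows "comm_monoid (quotient_monoid G r)"
  by (rule comm_monoidI) (auto simp: quotient_carrier quotient_one quotient_mult[OF r] m_ac)

text \<open>With \<open>f\<close> the equality of fractions, this yields explicit congruences on the
  localization, against which a generated congruence can be compared.\<close>

lemma quotient_congruence:
  assumes f: "monoid_congruence G f" and r: "monoid_congruence G r" and "f \<subseteq> r"
  shows "monoid_congruence (quotient_monoid G f) {(f `` {a}, f `` {b}) | a b. (a, b) \<in> r}"
    (is "monoid_congruence ?M ?R")
proof -
  \<comment> \<open>Since \<open>f\<close> refines \<open>r\<close>, the descended relation can be
    tested on any representatives, which is what transitivity needs.\<close>
  have rep: "(a, b) \<in> r" if "(f `` {a}, f `` {b}) \<in> ?R" "a \<in> carrier G" "b \<in> carrier G" for a b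
  proof -
    obtain a' b' where ab: "f `` {a} = f `` {a'}" "f `` {b} = f `` {b'}" "(a', b') \<in> r"
      using \<open>(f `` {a}, f `` {b}) \<in> ?R\<close> by blast
    moreover have "a' \<in> carrier G" "b' \<in> carrier G"
      using monoid_congruenceD(3)[OF r ab(3)] by simp_all
    ultimately have "(a, a') \<in> f" "(b, b') \<in> f"
      using that(2,3) class_eq_iff[OF f] by simp_all
    then show ?thesis
      using ab \<open>f \<subseteq> r\<close> monoid_congruenceD(5,6)[OF r] by (meson subsetD)
  qed
  show ?thesis
  proof (rule monoid_congruenceI)
    show "?R \<subseteq> carrier ?M \<times> carrier ?M"
      using monoid_congruenceD(3)[OF r] unfolding quotient_carrier by blast
    show "(A, A) \<in> ?R" if "A \<in> carrier ?M" for A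
      using that monoid_congruenceD(4)[OF r] unfolding quotient_carrier by blast
    show "(B, A) \<in> ?R" if "(A, B) \<in> ?R" for A B
      using that monoid_congruenceD(5)[OF r] by blast
    show "(A, C) \<in> ?R" if AB: "(A, B) \<in> ?R" and BC: "(B, C) \<in> ?R" for A B C
    proof -
      obtain a b where ab: "A = f `` {a}" "B = f `` {b}" "(a, b) \<in> r"
        using AB by blast
      obtain c where c: "C = f `` {c}" "c \<in> carrier G"
        using BC monoid_congruenceD(3)[OF r] by blast
      have "(b, c) \<in> r"
        using rep BC ab c monoid_congruenceD(3)[OF r] by blast
      then show ?thesis
        using ab c monoid_congruenceD(6)[OF r] by blast
    qed
    show "(A \<otimes>\<^bsub>?M\<^esub> C, B \<otimes>\<^bsub>?M\<^esub> C) \<in> ?R" if AB: "(A, B) \<in> ?R" and C: "C \<in> carrier ?M" for A B C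
    proof -
      obtain a b where ab: "A = f `` {a}" "B = f `` {b}" "(a, b) \<in> r"
        using AB by blast
      obtain c where c: "C = f `` {c}" "c \<in> carrier G"
        using C unfolding quotient_carrier by blast
      have "(a \<otimes> c, b \<otimes> c) \<in> r"
        using monoid_congruenceD(2)[OF r] ab c by blast
      then show ?thesis
        using ab c quotient_mult[OF f] monoid_congruenceD(3)[OF r ab(3)] by auto
    qed
  qed
qed

text \<open>The hypothesis puts the full relation on the carrier among the congruences being
  intersected, so the intersection stays inside the carrier.\<close>

lemma generated_congruence_congruence:
  assumes "S \<subseteq> carrier G \<times> carrier G"
  shows "monoid_congruence G (generated_congruence G S)"
proof -
  have "monoid_congruence G (carrier G \<times> carrier G)"
    by (rule monoid_congruenceI) auto
  then have ex: "generated_congruence G S \<subseteq> carrier G \<times> carrier G"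
    using assms unfolding generated_congruence_def by blast
  show ?thesis
    by (rule monoid_congruenceI[OF ex])
      (auto simp: generated_congruence_def intro: monoid_congruenceD)
qed

lemma generated_ideal_eq:
  assumes "x \<in> carrier G"
  shows "generated_ideal G x = (\<lambda>c. x \<otimes> c) ` carrier G"
proof
  have "monoid_ideal G ((\<lambda>c. x \<otimes> c) ` carrier G)"
    using assms unfolding monoid_ideal_def by (auto simp: m_assoc)
  moreover have "x \<in> (\<lambda>c. x \<otimes> c) ` carrier G"
    using assms by (metis imageI one_closed r_one)
  ultimately show "generated_ideal G x \<subseteq> (\<lambda>c. x \<otimes> c) ` carrier G"
    unfolding generated_ideal_def by blast
  show "(\<lambda>c. x \<otimes> c) ` carrier G \<subseteq> generated_ideal G x"
    unfolding generated_ideal_def monoid_ideal_def by blast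
qed

end

lemma self_in_generated_ideal: "x \<in> generated_ideal M x"
  unfolding generated_ideal_def by blast

section \<open>Localization at a prime\<close>

text \<open>Equality of fractions with \<open>r\<close> in place of equality in the
  cross-multiplication. Taking \<open>r\<close> to be equality on the carrier recovers
  \<open>fraction_rel\<close>, so one proof of the congruence laws serves both.\<close>

definition fraction_congruence ::
  "('a, 'b) monoid_scheme \<Rightarrow> 'a rel \<Rightarrow> 'a set \<Rightarrow> ('a \<times> 'a) rel" where
  "fraction_congruence Q r P =
     {((a, s), (b, t)) | a s b t.
        a \<in> carrier Q \<and> b \<in> carrier Q \<and> s \<in> carrier Q - P \<and> t \<in> carrier Q - P \<and>
        (\<exists>u \<in> carrier Q - P. (u \<otimes>\<^bsub>Q\<^esub> (a \<otimes>\<^bsub>Q\<^esub> t), u \<otimes>\<^bsub>Q\<^esub> (b \<otimes>\<^bsub>Q\<^esub> s)) \<in> r)}"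

locale comm_monoid_prime = comm_monoid Q for Q (structure) +
  fixes P
  assumes prime: "monoid_prime Q P"
begin

abbreviation fractions where "fractions \<equiv> Q \<times>\<times> Q\<lparr>carrier := carrier Q - P\<rparr>"

lemma compl_closed [simp]:
  "\<one> \<in> carrier Q - P"
  "s \<in> carrier Q - P \<Longrightarrow> t \<in> carrier Q - P \<Longrightarrow> s \<otimes> t \<in> carrier Q - P"
  using prime unfolding monoid_prime_def by (auto dest: submonoid.one_closed submonoid.m_closed)

lemma prime_subset: "P \<subseteq> carrier Q"
  using prime unfolding monoid_prime_def monoid_ideal_def by blast

lemma comm_monoid_fractions: "comm_monoid fractions"
  by (rule comm_monoidI) (use compl_closed in \<open>auto simp: DirProd_def m_ac\<close>)

lemma fraction_congruence_congruence:
  assumes r: "monoid_congruence Q r"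
  shows "monoid_congruence fractions (fraction_congruence Q r P)"
    (is "monoid_congruence _ ?F")
proof (rule monoid_congruenceI)
  show "?F \<subseteq> carrier fractions \<times> carrier fractions"
    unfolding fraction_congruence_def by auto
  show "(x, x) \<in> ?F" if "x \<in> carrier fractions" for x
    using that monoid_congruenceD(4)[OF r] compl_closed(1)
    unfolding fraction_congruence_def by fastforce
  show "(y, x) \<in> ?F" if "(x, y) \<in> ?F" for x y
    using that monoid_congruenceD(5)[OF r] unfolding fraction_congruence_def by blast
  show "(x, z) \<in> ?F" if xy: "(x, y) \<in> ?F" and yz: "(y, z) \<in> ?F" for x y z
  proof -
    obtain a s b t u where 1: "x = (a, s)" "y = (b, t)"
      "a \<in> carrier Q" "b \<in> carrier Q" "s \<in> carrier Q - P" "t \<in> carrier Q - P"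
      "u \<in> carrier Q - P" "(u \<otimes> (a \<otimes> t), u \<otimes> (b \<otimes> s)) \<in> r"
      using xy unfolding fraction_congruence_def by blast
    obtain c k v where 2: "z = (c, k)" "c \<in> carrier Q" "k \<in> carrier Q - P"
      "v \<in> carrier Q - P" "(v \<otimes> (b \<otimes> k), v \<otimes> (c \<otimes> t)) \<in> r"
      using yz 1 unfolding fraction_congruence_def by blast
    \<comment> \<open>The two relations are scaled so that they meet in a common middle term. The
      middle denominator \<open>t\<close> cannot be cancelled and joins the witness, which becomes
      \<open>u \<otimes> v \<otimes> t\<close>.\<close>
    have "(u \<otimes> (a \<otimes> t) \<otimes> (v \<otimes> k), u \<otimes> (b \<otimes> s) \<otimes> (v \<otimes> k)) \<in> r"
      by (rule monoid_congruenceD(2)[OF r]) (use 1 2 in auto)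
    moreover have "(v \<otimes> (b \<otimes> k) \<otimes> (u \<otimes> s), v \<otimes> (c \<otimes> t) \<otimes> (u \<otimes> s)) \<in> r"
      by (rule monoid_congruenceD(2)[OF r]) (use 1 2 in auto)
    moreover have "u \<otimes> (a \<otimes> t) \<otimes> (v \<otimes> k) = u \<otimes> v \<otimes> t \<otimes> (a \<otimes> k)"
      "u \<otimes> (b \<otimes> s) \<otimes> (v \<otimes> k) = v \<otimes> (b \<otimes> k) \<otimes> (u \<otimes> s)"
      "v \<otimes> (c \<otimes> t) \<otimes> (u \<otimes> s) = u \<otimes> v \<otimes> t \<otimes> (c \<otimes> s)"
      using 1 2 by (simp_all add: m_ac)
    ultimately have "(u \<otimes> v \<otimes> t \<otimes> (a \<otimes> k), u \<otimes> v \<otimes> t \<otimes> (c \<otimes> s)) \<in> r"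
      using monoid_congruenceD(6)[OF r] by metis
    moreover have "u \<otimes> v \<otimes> t \<in> carrier Q - P"
      using 1 2 compl_closed by metis
    ultimately show ?thesis
      using 1 2 unfolding fraction_congruence_def by blast
  qed
  show "(x \<otimes>\<^bsub>fractions\<^esub> z, y \<otimes>\<^bsub>fractions\<^esub> z) \<in> ?F"
    if xy: "(x, y) \<in> ?F" and z: "z \<in> carrier fractions" for x y z
  proof -
    obtain a s b t u where 1: "x = (a, s)" "y = (b, t)"
      "a \<in> carrier Q" "b \<in> carrier Q" "s \<in> carrier Q - P" "t \<in> carrier Q - P"
      "u \<in> carrier Q - P" "(u \<otimes> (a \<otimes> t), u \<otimes> (b \<otimes> s)) \<in> r"
      using xy unfolding fraction_congruence_def by blast
    obtain c k where 2: "z = (c, k)" "c \<in> carrier Q" "k \<in> carrier Q - P"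
      using z by auto
    have "(u \<otimes> (a \<otimes> t) \<otimes> (c \<otimes> k), u \<otimes> (b \<otimes> s) \<otimes> (c \<otimes> k)) \<in> r"
      by (rule monoid_congruenceD(2)[OF r]) (use 1 2 in auto)
    moreover have "u \<otimes> (a \<otimes> t) \<otimes> (c \<otimes> k) = u \<otimes> ((a \<otimes> c) \<otimes> (t \<otimes> k))"
      "u \<otimes> (b \<otimes> s) \<otimes> (c \<otimes> k) = u \<otimes> ((b \<otimes> c) \<otimes> (s \<otimes> k))"
      using 1 2 by (simp_all add: m_ac)
    ultimately have "(u \<otimes> ((a \<otimes> c) \<otimes> (t \<otimes> k)), u \<otimes> ((b \<otimes> c) \<otimes> (s \<otimes> k))) \<in> r"
      by metis
    moreover have "s \<otimes> k \<in> carrier Q - P" "t \<otimes> k \<in> carrier Q - P"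
      "a \<otimes> c \<in> carrier Q" "b \<otimes> c \<in> carrier Q"
      using 1 2 compl_closed by auto
    ultimately show ?thesis
      using 1 2 unfolding fraction_congruence_def DirProd_def by auto
  qed
qed

lemma fraction_congruence_mono:
  assumes "r \<subseteq> r'"
  shows "fraction_congruence Q r P \<subseteq> fraction_congruence Q r' P"
proof
  fix z assume "z \<in> fraction_congruence Q r P"
  then obtain a s b t u where "z = ((a, s), (b, t))" "a \<in> carrier Q" "b \<in> carrier Q"
    "s \<in> carrier Q - P" "t \<in> carrier Q - P" "u \<in> carrier Q - P"
    "(u \<otimes> (a \<otimes> t), u \<otimes> (b \<otimes> s)) \<in> r"
    unfolding fraction_congruence_def by blast
  moreover from this have "(u \<otimes> (a \<otimes> t), u \<otimes> (b \<otimes> s)) \<in> r'"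
    using assms by auto
  ultimately show "z \<in> fraction_congruence Q r' P"
    unfolding fraction_congruence_def by blast
qed

lemma fraction_rel_eq: "fraction_rel Q P = fraction_congruence Q (Id_on (carrier Q)) P"
  unfolding fraction_rel_def fraction_congruence_def by (auto simp: Id_on_iff)

lemma fraction_rel_congruence: "monoid_congruence fractions (fraction_rel Q P)"
proof -
  have "monoid_congruence Q (Id_on (carrier Q))"
    by (rule monoid_congruenceI) auto
  then show ?thesis
    unfolding fraction_rel_eq by (rule fraction_congruence_congruence)
qed

lemma comm_monoid_localization: "comm_monoid (localization Q P)"
  unfolding localization_def
  using comm_monoid.comm_monoid_quotient[OF comm_monoid_fractions fraction_rel_congruence] .

lemma to_localization_closed: "a \<in> carrier Q \<Longrightarrow> to_localization Q P a \<in> carrier (localization Q P)"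
  unfolding localization_def comm_monoid.quotient_carrier[OF comm_monoid_fractions]
    to_localization_def using compl_closed(1) by auto

lemma fractions_mult: "(a, s) \<otimes>\<^bsub>fractions\<^esub> (b, t) = (a \<otimes> b, s \<otimes> t)"
  by (simp add: DirProd_def)

lemma to_localization_mult:
  assumes "a \<in> carrier Q" "b \<in> carrier Q"
  shows "to_localization Q P (a \<otimes> b) =
    to_localization Q P a \<otimes>\<^bsub>localization Q P\<^esub> to_localization Q P b"
  using comm_monoid.quotient_mult[OF comm_monoid_fractions fraction_rel_congruence,
      of "(a, \<one>)" "(b, \<one>)"] assms compl_closed(1)
  unfolding localization_def to_localization_def fractions_mult by auto

lemma to_localization_one: "to_localization Q P \<one> = \<one>\<^bsub>localization Q P\<^esub>"
  unfolding localization_def comm_monoid.quotient_one[OF comm_monoid_fractions]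
    to_localization_def by (simp add: DirProd_def)

text \<open>The inverse is the class of \<open>(\<one>, s)\<close>, because \<open>(s, s)\<close>
  and \<open>(\<one>, \<one>)\<close> represent the same fraction.\<close>

lemma to_localization_inverse:
  assumes s: "s \<in> carrier Q - P"
  shows "\<exists>t \<in> carrier (localization Q P).
    to_localization Q P s \<otimes>\<^bsub>localization Q P\<^esub> t = \<one>\<^bsub>localization Q P\<^esub>"
proof -
  let ?F = "fraction_rel Q P"
  have c: "(\<one>, s) \<in> carrier fractions" "(s, \<one>) \<in> carrier fractions" "(s, s) \<in> carrier fractions"
    "(\<one>, \<one>) \<in> carrier fractions"
    using s compl_closed(1) by auto
  have "((s, s), (\<one>, \<one>)) \<in> ?F"
    unfolding fraction_rel_def using s compl_closed(1) by auto
  then have "?F `` {(s, s)} = ?F `` {(\<one>, \<one>)}"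
    using class_eq_iff[OF fraction_rel_congruence] c by blast
  moreover have "?F `` {(s, \<one>)} \<otimes>\<^bsub>localization Q P\<^esub> ?F `` {(\<one>, s)} = ?F `` {(s, s)}"
    using comm_monoid.quotient_mult[OF comm_monoid_fractions fraction_rel_congruence c(2,1)] s
    unfolding localization_def fractions_mult by simp
  moreover have "?F `` {(\<one>, s)} \<in> carrier (localization Q P)"
    unfolding localization_def comm_monoid.quotient_carrier[OF comm_monoid_fractions]
    using c by blast
  ultimately show ?thesis
    unfolding to_localization_def
    using to_localization_one[unfolded to_localization_def] by auto
qed

end

text \<open>Here \<open>r\<close> is any relation on the carrier, so that the locale can be
  interpreted both at the given congruence and at every iterated collapse.\<close>

locale comm_monoid_localized = comm_monoid_prime +
  fixes r
  assumes rel_subset: "r \<subseteq> carrier Q \<times> carrier Q"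
begin

abbreviation L where "L \<equiv> local_quotient Q r P"
abbreviation \<beta> where "\<beta> \<equiv> local_class Q r P"

lemma localized_congruence_congruence:
  "monoid_congruence (localization Q P) (localized_congruence Q r P)"
  unfolding localized_congruence_def
  by (rule comm_monoid.generated_congruence_congruence[OF comm_monoid_localization])
    (use rel_subset to_localization_closed in blast)

sublocale L: comm_monoid L
  unfolding local_quotient_def
  using comm_monoid.comm_monoid_quotient[OF comm_monoid_localization
      localized_congruence_congruence] .

lemma local_class_closed [simp]: "a \<in> carrier Q \<Longrightarrow> \<beta> a \<in> carrier L"
  unfolding local_quotient_def comm_monoid.quotient_carrier[OF comm_monoid_localization]
    local_class_def using to_localization_closed by blast

lemma local_class_mult:
  "a \<in> carrier Q \<Longrightarrow> b \<in> carrier Q \<Longrightarrow> \<beta> (a \<otimes> b) = \<beta> a \<otimes>\<^bsub>L\<^esub> \<beta> b"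
  unfolding local_quotient_def local_class_def
  by (simp add: to_localization_mult to_localization_closed
      comm_monoid.quotient_mult[OF comm_monoid_localization localized_congruence_congruence])

lemma local_class_unit:
  assumes "s \<in> carrier Q - P"
  shows "\<beta> s \<in> Units L"
proof -
  let ?C = "localized_congruence Q r P"
  obtain t where t: "t \<in> carrier (localization Q P)"
    "to_localization Q P s \<otimes>\<^bsub>localization Q P\<^esub> t = \<one>\<^bsub>localization Q P\<^esub>"
    using to_localization_inverse[OF assms] by blast
  have "\<beta> s \<otimes>\<^bsub>L\<^esub> ?C `` {t} = \<one>\<^bsub>L\<^esub>"
    using t assms to_localization_closed
    unfolding local_quotient_def local_class_def
    by (simp add: comm_monoid.quotient_one[OF comm_monoid_localization]
        comm_monoid.quotient_mult[OF comm_monoid_localization localized_congruence_congruence])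
  moreover have "?C `` {t} \<in> carrier L"
    unfolding local_quotient_def comm_monoid.quotient_carrier[OF comm_monoid_localization]
    using t by blast
  ultimately show ?thesis
    using assms L.m_comm[of "\<beta> s" "?C `` {t}"] unfolding Units_def by auto
qed

lemma local_class_eqI:
  assumes "(a, b) \<in> r"
  shows "\<beta> a = \<beta> b"
proof -
  have "(to_localization Q P a, to_localization Q P b) \<in> localized_congruence Q r P"
    unfolding localized_congruence_def generated_congruence_def using assms by blast
  then show ?thesis
    unfolding local_class_def
    using assms equiv_class_eq monoid_congruenceD(1)[OF localized_congruence_congruence] by metis
qed

text \<open>A generated congruence lies below every congruence containing its generators. Relating
  fractions through \<open>r\<close> gives such an upper bound, and clearing denominators brings it
  back to \<open>Q\<close>.\<close>

lemma local_class_eqD: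
  assumes r: "monoid_congruence Q r" and ab: "a \<in> carrier Q" "b \<in> carrier Q" "\<beta> a = \<beta> b"
  shows "\<exists>s \<in> carrier Q - P. (a \<otimes> s, b \<otimes> s) \<in> r"
proof -
  let ?F = "fraction_rel Q P" and ?R = "fraction_congruence Q r P"
  let ?S = "{(?F `` {x}, ?F `` {y}) | x y. (x, y) \<in> ?R}"
  have "Id_on (carrier Q) \<subseteq> r"
    using monoid_congruenceD(4)[OF r] by auto
  then have sub: "?F \<subseteq> ?R"
    unfolding fraction_rel_eq by (rule fraction_congruence_mono)
  note R = fraction_congruence_congruence[OF r]
  have S: "monoid_congruence (localization Q P) ?S"
    unfolding localization_def
    by (rule comm_monoid.quotient_congruence[OF comm_monoid_fractions fraction_rel_congruence R sub])
  have emb: "((x, \<one>), (y, \<one>)) \<in> ?R" if "(x, y) \<in> r" for x y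
    unfolding fraction_congruence_def using that monoid_congruenceD(3)[OF r that] compl_closed(1)
    by (auto intro!: bexI[of _ \<one>])
  have "{(to_localization Q P x, to_localization Q P y) | x y. (x, y) \<in> r} \<subseteq> ?S"
    unfolding to_localization_def using emb by blast
  then have "localized_congruence Q r P \<subseteq> ?S"
    unfolding localized_congruence_def generated_congruence_def using S by blast
  moreover have "(to_localization Q P a, to_localization Q P b) \<in> localized_congruence Q r P"
    using ab to_localization_closed class_eq_iff[OF localized_congruence_congruence]
    unfolding local_class_def by blast
  ultimately have "(?F `` {(a, \<one>)}, ?F `` {(b, \<one>)}) \<in> ?S"
    unfolding to_localization_def by (rule subsetD)
  then obtain x y where xy: "?F `` {(a, \<one>)} = ?F `` {x}" "?F `` {(b, \<one>)} = ?F `` {y}"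
    "(x, y) \<in> ?R"
    by blast
  \<comment> \<open>The pairs \<open>x\<close> and \<open>y\<close> are only some representatives of
    the two fractions; the inclusion of \<open>?F\<close> in \<open>?R\<close> absorbs the
    difference.\<close>
  have "(a, \<one>) \<in> carrier fractions" "(b, \<one>) \<in> carrier fractions"
    using ab compl_closed(1) by auto
  moreover have "x \<in> carrier fractions" "y \<in> carrier fractions"
    using monoid_congruenceD(3)[OF R xy(3)] by blast+
  ultimately have "((a, \<one>), x) \<in> ?F" "((b, \<one>), y) \<in> ?F"
    using xy(1,2) class_eq_iff[OF fraction_rel_congruence] by blast+
  then have "((a, \<one>), x) \<in> ?R" "(y, (b, \<one>)) \<in> ?R"
    using sub monoid_congruenceD(5)[OF R] by blast+
  then have "((a, \<one>), (b, \<one>)) \<in> ?R"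
    using xy(3) monoid_congruenceD(6)[OF R] by blast
  then obtain u where u: "u \<in> carrier Q - P" "(u \<otimes> a, u \<otimes> b) \<in> r"
    unfolding fraction_congruence_def using ab by auto
  then have "(a \<otimes> u, b \<otimes> u) \<in> r"
    using ab by (simp add: m_comm)
  then show ?thesis
    using u by blast
qed

text \<open>The image of \<open>s\<close> is a unit of \<open>L\<close>, so multiplying by its
  inverse undoes the translation. This handles translations by elements outside \<open>P\<close> in
  the soccular collapse.\<close>

lemma generated_ideal_unit_cancel:
  assumes "a \<in> carrier Q" "w \<in> carrier Q" "s \<in> carrier Q - P"
    and "\<beta> (a \<otimes> s) \<in> generated_ideal L (\<beta> w)"
  shows "\<beta> a \<in> generated_ideal L (\<beta> w)"
proof -
  obtain c where c: "c \<in> carrier L" "\<beta> a \<otimes>\<^bsub>L\<^esub> \<beta> s = \<beta> w \<otimes>\<^bsub>L\<^esub> c"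
    using assms local_class_mult by (auto simp: L.generated_ideal_eq)
  obtain t where t: "t \<in> carrier L" "\<beta> s \<otimes>\<^bsub>L\<^esub> t = \<one>\<^bsub>L\<^esub>"
    using local_class_unit[OF assms(3)] unfolding Units_def by blast
  have "\<beta> a = \<beta> a \<otimes>\<^bsub>L\<^esub> \<beta> s \<otimes>\<^bsub>L\<^esub> t"
    using assms t by (simp add: L.m_assoc)
  also have "\<dots> = \<beta> w \<otimes>\<^bsub>L\<^esub> (c \<otimes>\<^bsub>L\<^esub> t)"
    using assms c t by (simp add: L.m_assoc)
  finally show ?thesis
    using assms c t by (auto simp: L.generated_ideal_eq)
qed

section \<open>Coprincipal and soccular components\<close>

text \<open>Related elements have equal images, so the linking unit can be the identity; the clause
  that applies depends on whether the common image divides that of \<open>w\<close>.\<close>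

lemma coprincipal_component_contains:
  assumes "w \<in> carrier Q"
  shows "r \<subseteq> coprincipal_component Q r P w"
proof
  fix x assume "x \<in> r"
  then obtain a b where x: "x = (a, b)" "(a, b) \<in> r" "a \<in> carrier Q" "b \<in> carrier Q"
    using rel_subset by auto
  have "\<beta> b = \<beta> a \<otimes>\<^bsub>L\<^esub> \<one>\<^bsub>L\<^esub>" "\<one>\<^bsub>L\<^esub> \<in> Units L"
    using x local_class_eqI by auto
  moreover have "\<exists>c\<in>carrier L. \<beta> a \<otimes>\<^bsub>L\<^esub> c = \<beta> w" if "\<beta> w \<in> generated_ideal L (\<beta> a)"
    using that x L.generated_ideal_eq[of "\<beta> a"] by auto
  ultimately show "x \<in> coprincipal_component Q r P w"
    using x local_class_eqI[OF x(2)] unfolding coprincipal_component_def Let_def by fastforce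
qed

text \<open>Translation only shrinks principal ideals, so the first clause persists. In the second,
  the linking unit fixes the image of \<open>w\<close>: a multiplier taking the image of
  \<open>a \<otimes> q\<close> to it does the same for \<open>b \<otimes> q\<close>, and if there is
  none, the translated pair falls under the first clause.\<close>

lemma coprincipal_component_translate:
  assumes w: "w \<in> carrier Q" and q: "q \<in> carrier Q"
    and ab: "(a, b) \<in> coprincipal_component Q r P w"
  shows "(a \<otimes> q, b \<otimes> q) \<in> coprincipal_component Q r P w"
proof -
  have c: "a \<in> carrier Q" "b \<in> carrier Q"
    using ab unfolding coprincipal_component_def by (auto simp: Let_def)
  have ideal: "\<beta> w \<in> generated_ideal L (\<beta> x)"
    if x: "\<beta> w \<in> generated_ideal L (\<beta> (x \<otimes> q))" "x \<in> carrier Q" for x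
  proof -
    obtain d where "d \<in> carrier L" "\<beta> w = \<beta> x \<otimes>\<^bsub>L\<^esub> (\<beta> q \<otimes>\<^bsub>L\<^esub> d)"
      using x q by (auto simp: L.generated_ideal_eq local_class_mult L.m_assoc)
    then show ?thesis
      using q x by (auto simp: L.generated_ideal_eq)
  qed
  consider "\<beta> w \<notin> generated_ideal L (\<beta> a)" "\<beta> w \<notin> generated_ideal L (\<beta> b)"
    | u d where "u \<in> Units L" "\<beta> b = \<beta> a \<otimes>\<^bsub>L\<^esub> u" "d \<in> carrier L" "\<beta> a \<otimes>\<^bsub>L\<^esub> d = \<beta> w"
      "\<beta> b \<otimes>\<^bsub>L\<^esub> d = \<beta> w"
    using ab unfolding coprincipal_component_def Let_def by blast
  then show ?thesis
  proof cases
    case 1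
    then show ?thesis
      using c q ideal unfolding coprincipal_component_def Let_def by auto
  next
    case 2
    have u: "u \<in> carrier L"
      using 2 by auto
    have uw: "\<beta> w \<otimes>\<^bsub>L\<^esub> u = \<beta> w"
      using L.common_multiple_fixed[of "\<beta> a" u d] 2 u c by simp
    have bq: "\<beta> (b \<otimes> q) = \<beta> (a \<otimes> q) \<otimes>\<^bsub>L\<^esub> u"
      using 2 u c q by (simp add: local_class_mult L.m_ac)
    show ?thesis
    proof (cases "\<beta> w \<in> generated_ideal L (\<beta> (a \<otimes> q))")
      case True
      then obtain e where e: "e \<in> carrier L" "\<beta> w = \<beta> (a \<otimes> q) \<otimes>\<^bsub>L\<^esub> e"
        using c q by (auto simp: L.generated_ideal_eq)
      have "\<beta> (b \<otimes> q) \<otimes>\<^bsub>L\<^esub> e = \<beta> (a \<otimes> q) \<otimes>\<^bsub>L\<^esub> e \<otimes>\<^bsub>L\<^esub> u"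
        using bq e u c q by (simp add: L.m_ac)
      then have "\<beta> (b \<otimes> q) \<otimes>\<^bsub>L\<^esub> e = \<beta> w"
        using e uw by simp
      then show ?thesis
        using c q bq 2 e unfolding coprincipal_component_def Let_def by auto
    next
      case False
      have "\<beta> w \<notin> generated_ideal L (\<beta> (b \<otimes> q))"
      proof
        assume "\<beta> w \<in> generated_ideal L (\<beta> (b \<otimes> q))"
        then obtain e where "e \<in> carrier L" "\<beta> w = \<beta> (a \<otimes> q) \<otimes>\<^bsub>L\<^esub> (u \<otimes>\<^bsub>L\<^esub> e)"
          using c q u bq by (auto simp: L.generated_ideal_eq L.m_assoc)
        then show False
          using False c q u by (auto simp: L.generated_ideal_eq)
      qed
      then show ?thesis
        using False c q unfolding coprincipal_component_def Let_def by auto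
    qed
  qed
qed

text \<open>The image of \<open>w\<close> lies in its own ideal, which excludes the first clause.
  The second supplies a unit that carries one image to the other and fixes the image of
  \<open>w\<close>, which is one of the two.\<close>

lemma coprincipal_component_cogenerator:
  assumes "(x, y) \<in> coprincipal_component Q r P w" and w: "w = x \<or> w = y"
  shows "\<beta> x = \<beta> y"
proof -
  have c: "x \<in> carrier Q" "y \<in> carrier Q"
    using assms unfolding coprincipal_component_def by (auto simp: Let_def)
  obtain u d where u: "u \<in> Units L" "\<beta> y = \<beta> x \<otimes>\<^bsub>L\<^esub> u" and d: "d \<in> carrier L"
    "\<beta> x \<otimes>\<^bsub>L\<^esub> d = \<beta> w" "\<beta> y \<otimes>\<^bsub>L\<^esub> d = \<beta> w"
    using assms self_in_generated_ideal[of "\<beta> w" L]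
    unfolding coprincipal_component_def Let_def by auto
  have uc: "u \<in> carrier L"
    using u by auto
  have uw: "\<beta> w \<otimes>\<^bsub>L\<^esub> u = \<beta> w"
    using L.common_multiple_fixed[of "\<beta> x" u d] u uc d c by simp
  from w show ?thesis
  proof
    assume "w = x"
    then show ?thesis
      using u uw by simp
  next
    \<comment> \<open>Here the unit fixes the target instead of the source: both sides below equal
      \<open>\<beta> y\<close>, and \<open>u\<close> is then cancelled.\<close>
    assume "w = y"
    then have "\<beta> x \<otimes>\<^bsub>L\<^esub> u = \<beta> y \<otimes>\<^bsub>L\<^esub> u"
      using u uw by simp
    moreover obtain v where "v \<in> carrier L" "u \<otimes>\<^bsub>L\<^esub> v = \<one>\<^bsub>L\<^esub>"
      using u unfolding Units_def by blast
    ultimately show ?thesis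
      using c uc local_class_closed L.m_assoc L.r_one by metis
  qed
qed

text \<open>If \<open>q\<close> lies in \<open>P\<close>, the definition of the collapse already
  puts the translate of an added pair into \<open>r\<close>. Otherwise \<open>q\<close> becomes a
  unit, so the translated pair stays outside the ideal of \<open>w\<close>, and \<open>q\<close>
  commutes past each \<open>p\<close>.\<close>

lemma soccular_collapse_translate:
  assumes w: "w \<in> carrier Q" and q: "q \<in> carrier Q"
    and translate: "\<And>a b. (a, b) \<in> r \<Longrightarrow> (a \<otimes> q, b \<otimes> q) \<in> r"
    and ab: "(a, b) \<in> soccular_collapse Q P w r"
  shows "(a \<otimes> q, b \<otimes> q) \<in> soccular_collapse Q P w r"
proof -
  have c: "a \<in> carrier Q" "b \<in> carrier Q"
    using ab unfolding soccular_collapse_def by (auto simp: Let_def)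
  consider "(a \<otimes> q, b \<otimes> q) \<in> r" | "q \<notin> P" "\<beta> a \<notin> generated_ideal L (\<beta> w)"
    "\<beta> b \<notin> generated_ideal L (\<beta> w)" "\<forall>p\<in>P. (a \<otimes> p, b \<otimes> p) \<in> r"
    using ab translate unfolding soccular_collapse_def Let_def by blast
  then show ?thesis
  proof cases
    case 1
    then show ?thesis
      using c q unfolding soccular_collapse_def by (auto simp: Let_def)
  next
    case 2
    have "(a \<otimes> q \<otimes> p, b \<otimes> q \<otimes> p) \<in> r" if "p \<in> P" for p
    proof -
      have "(a \<otimes> p \<otimes> q, b \<otimes> p \<otimes> q) \<in> r" "p \<in> carrier Q"
        using 2 that translate prime_subset by auto
      then show ?thesis
        using c q by (simp add: m_ac)
    qed
    moreover have "\<beta> (a \<otimes> q) \<notin> generated_ideal L (\<beta> w)" "\<beta> (b \<otimes> q) \<notin> generated_ideal L (\<beta> w)"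
      using generated_ideal_unit_cancel c q w 2 by blast+
    ultimately show ?thesis
      using c q unfolding soccular_collapse_def by (auto simp: Let_def)
  qed
qed

end

section \<open>Iterated collapses and the soccular component\<close>

context comm_monoid_prime
begin

text \<open>For every relation \<open>s\<close>, the image of \<open>w\<close> lies in the ideal it
  generates, so no added pair has \<open>w\<close> as a member.\<close>

lemma soccular_collapse_cogenerator:
  assumes "(x, y) \<in> soccular_collapse Q P w s" and "w = x \<or> w = y"
  shows "(x, y) \<in> s"
  using assms self_in_generated_ideal unfolding soccular_collapse_def Let_def by fast

lemma iterated_collapse_cogenerator:
  assumes "(x, y) \<in> (soccular_collapse Q P w ^^ i) s" and "w = x \<or> w = y"
  shows "(x, y) \<in> s"
  using assms by (induction i) (auto dest: soccular_collapse_cogenerator)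

lemma soccular_component_translate:
  assumes r: "r \<subseteq> carrier Q \<times> carrier Q" and w: "w \<in> carrier Q" and q: "q \<in> carrier Q"
    and ab: "(a, b) \<in> soccular_component Q r P w"
  shows "(a \<otimes> q, b \<otimes> q) \<in> soccular_component Q r P w"
proof -
  let ?C = "\<lambda>i. (soccular_collapse Q P w ^^ i) (coprincipal_component Q r P w)"
  \<comment> \<open>Inclusion in the carrier is carried through the induction because it allows the
    locale to be interpreted at the next stage.\<close>
  have "?C i \<subseteq> carrier Q \<times> carrier Q \<and> (\<forall>a b. (a, b) \<in> ?C i \<longrightarrow> (a \<otimes> q, b \<otimes> q) \<in> ?C i)" for i
  proof (induction i)
    case 0
    interpret comm_monoid_localized Q P r
      by unfold_locales (fact r)
    show ?case
      using coprincipal_component_translate[OF w q]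
      by (auto simp: coprincipal_component_def Let_def)
  next
    case (Suc i)
    \<comment> \<open>A fresh interpretation: the local quotient is rebuilt at each stage from the
      relation being collapsed.\<close>
    interpret comm_monoid_localized Q P "?C i"
      by unfold_locales (use Suc in blast)
    have "?C (Suc i) \<subseteq> carrier Q \<times> carrier Q"
      by (auto simp: soccular_collapse_def Let_def)
    then show ?case
      using soccular_collapse_translate[OF w q] Suc by simp
  qed
  then show ?thesis
    using ab unfolding soccular_component_def soccular_closure_def by blast
qed

text \<open>Membership of a pair containing \<open>w\<close> descends through all collapses to the
  coprincipal component, where it forces equal images.\<close>

lemma key_witness_not_in_soccular_component:
  assumes r: "r \<subseteq> carrier Q \<times> carrier Q" and w: "w = x \<or> w = y"
    and ne: "local_class Q r P x \<noteq> local_class Q r P y"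
  shows "(x, y) \<notin> soccular_component Q r P w"
proof
  assume "(x, y) \<in> soccular_component Q r P w"
  then have *: "(x, y) \<in> coprincipal_component Q r P w"
    unfolding soccular_component_def soccular_closure_def
    using iterated_collapse_cogenerator w by blast
  interpret comm_monoid_localized Q P r
    by unfold_locales (fact r)
  show False
    using coprincipal_component_cogenerator[OF * w] ne by blast
qed

end

section \<open>Existence of key witnesses\<close>

text \<open>The chain condition concerns congruences, so each ideal is encoded by its Rees
  congruence, which identifies all its elements. Empty and one-element ideals have the same Rees
  congruence, hence the case split and the base point.\<close>

lemma noetherian_ideal_chain:
  fixes I :: "nat \<Rightarrow> 'a set"
  assumes noeth: "noetherian_comm_monoid Q"
    and ideal: "\<And>i. monoid_ideal Q (I i)" and incr: "\<And>i. I i \<subseteq> I (Suc i)"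
  shows "\<exists>n. \<forall>i\<ge>n. I i = I n"
proof (cases "\<forall>i. I i = {}")
  case True
  then show ?thesis by auto
next
  case False
  then obtain m where m: "I m \<noteq> {}" by blast
  have mono: "i \<le> j \<Longrightarrow> I i \<subseteq> I j" for i j
    using lift_Suc_mono_le[of I] incr by blast
  let ?rees = "\<lambda>i. Id_on (carrier Q) \<union> I i \<times> I i"
  interpret comm_monoid Q
    using noeth unfolding noetherian_comm_monoid_def by blast
  have "monoid_congruence Q (?rees i)" for i
    by (rule monoid_congruenceI) (use ideal[of i] in \<open>auto simp: monoid_ideal_def\<close>)
  moreover have "?rees i \<subseteq> ?rees (Suc i)" for i
    using incr[of i] by auto
  ultimately obtain n where n: "\<forall>i\<ge>n. ?rees i = ?rees n"
    using noeth unfolding noetherian_comm_monoid_def by (elim conjE allE[of _ ?rees]) auto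
  \<comment> \<open>From \<open>m\<close> on the ideals share a base point \<open>y\<close>, and
    from \<open>n\<close> on the Rees congruences agree. So \<open>x\<close> is related to
    \<open>y\<close> at stage \<open>max m n\<close>: it equals \<open>y\<close> or lies in the
    ideal with it.\<close>
  have "I i \<subseteq> I (max m n)" if i: "i \<ge> max m n" for i
  proof
    fix x assume x: "x \<in> I i"
    obtain y where y: "y \<in> I m" using m by blast
    then have y': "y \<in> I i" "y \<in> I (max m n)"
      using mono[of m i] mono[of m "max m n"] i by auto
    then have "(x, y) \<in> ?rees i"
      using x by blast
    moreover have "?rees i = ?rees (max m n)"
      using n i by (metis max.cobounded2 order.trans)
    ultimately show "x \<in> I (max m n)"
      using y' by (auto simp: Id_on_iff)
  qed
  then show ?thesis
    using mono by (metis subset_antisym)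
qed

text \<open>Without a maximal member, dependent choice would build a strictly increasing sequence of
  ideals.\<close>

lemma noetherian_maximal_ideal:
  assumes noeth: "noetherian_comm_monoid Q"
    and ideal: "\<And>I. I \<in> F \<Longrightarrow> monoid_ideal Q I" and "F \<noteq> {}"
  shows "\<exists>I \<in> F. \<forall>J \<in> F. I \<subseteq> J \<longrightarrow> J = I"
proof (rule ccontr)
  assume "\<not> ?thesis"
  then have step: "\<exists>J. J \<in> F \<and> I \<subset> J" if "I \<in> F" for I
    using that by blast
  have "\<exists>I. \<forall>n::nat. I n \<in> F \<and> I n \<subset> I (Suc n)"
    by (rule dependent_nat_choice) (use step \<open>F \<noteq> {}\<close> in auto)
  then obtain I where I: "\<And>n::nat. I n \<in> F" "\<And>n. I n \<subset> I (Suc n)"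
    by blast
  then have "monoid_ideal Q (I i)" "I i \<subseteq> I (Suc i)" for i
    using ideal by blast+
  then obtain n where "\<forall>i\<ge>n. I i = I n"
    using noetherian_ideal_chain[OF noeth] by blast
  then have "I (Suc n) = I n"
    by (meson le_SucI order_refl)
  then show False
    using I(2)[of n] by (metis psubset_eq)
qed

context comm_monoid
begin

text \<open>This mirrors the argument that a maximal annihilator is prime. For \<open>x\<close>
  outside the transporter of \<open>q\<close>, the transporter of \<open>q \<otimes> x\<close> is
  proper and contains that of \<open>q\<close>, so the two agree; hence \<open>x \<otimes> y\<close>
  lies in it only if \<open>y\<close> does.\<close>

lemma transporter_prime:
  assumes noeth: "noetherian_comm_monoid G" and r: "monoid_congruence G r"
    and ab: "a \<in> carrier G" "b \<in> carrier G" "(a, b) \<notin> r"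
  shows "\<exists>q \<in> carrier G. monoid_prime G {p \<in> carrier G. (a \<otimes> q \<otimes> p, b \<otimes> q \<otimes> p) \<in> r}"
proof -
  define T where "T q = {p \<in> carrier G. (a \<otimes> q \<otimes> p, b \<otimes> q \<otimes> p) \<in> r}" for q
  have ideal: "monoid_ideal G (T q)" if q: "q \<in> carrier G" for q
    unfolding monoid_ideal_def
  proof (intro conjI ballI)
    fix p c assume p: "p \<in> T q" and c: "c \<in> carrier G"
    then have "(a \<otimes> q \<otimes> p \<otimes> c, b \<otimes> q \<otimes> p \<otimes> c) \<in> r"
      unfolding T_def using monoid_congruenceD(2)[OF r] by blast
    then show "p \<otimes> c \<in> T q"
      using p c q ab unfolding T_def by (simp add: m_assoc)
  qed (auto simp: T_def)
  \<comment> \<open>The condition on \<open>q\<close> says that \<open>\<one> \<notin> T q\<close>,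
    so \<open>F\<close> consists of the proper transporters.\<close>
  define F where "F = {T q | q. q \<in> carrier G \<and> (a \<otimes> q, b \<otimes> q) \<notin> r}"
  have "T \<one> \<in> F"
    unfolding F_def using ab by force
  moreover have "monoid_ideal G I" if "I \<in> F" for I
    using that ideal unfolding F_def by blast
  ultimately obtain I where "I \<in> F" and I: "\<forall>J\<in>F. I \<subseteq> J \<longrightarrow> J = I"
    using noetherian_maximal_ideal[OF noeth, of F] by blast
  then obtain q where q: "q \<in> carrier G" "(a \<otimes> q, b \<otimes> q) \<notin> r" and "I = T q"
    unfolding F_def by blast
  have max: "T q' = T q" if "q' \<in> carrier G" "(a \<otimes> q', b \<otimes> q') \<notin> r" "T q \<subseteq> T q'" for q'
  proof -
    have "T q' \<in> F"
      unfolding F_def using that by blast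
    then show ?thesis
      using I that \<open>I = T q\<close> by simp
  qed
  have one: "\<one> \<notin> T q"
    using q ab unfolding T_def by simp
  have mult: "x \<otimes> y \<notin> T q" if x: "x \<in> carrier G - T q" and y: "y \<in> carrier G - T q" for x y
  proof -
    have "(a \<otimes> (q \<otimes> x), b \<otimes> (q \<otimes> x)) \<notin> r"
      using x q ab unfolding T_def by (simp add: m_assoc)
    moreover have shift: "p \<in> T (q \<otimes> x) \<longleftrightarrow> x \<otimes> p \<in> T q" if "p \<in> carrier G" for p
      using that x q ab unfolding T_def by (simp add: m_assoc)
    moreover have "T q \<subseteq> T (q \<otimes> x)"
    proof
      fix p assume p: "p \<in> T q"
      then have "p \<otimes> x \<in> T q" "p \<in> carrier G"
        using x ideal[OF q(1)] unfolding monoid_ideal_def by auto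
      then show "p \<in> T (q \<otimes> x)"
        using shift x by (simp add: m_comm)
    qed
    ultimately have "T (q \<otimes> x) = T q"
      using max x q by simp
    then show ?thesis
      using shift y by blast
  qed
  have "monoid_prime G (T q)"
    unfolding monoid_prime_def
    using ideal[OF q(1)] one mult by (auto intro!: submonoid.intro)
  then show ?thesis
    using q unfolding T_def by blast
qed

lemma separated_by_soccular_component:
  assumes noeth: "noetherian_comm_monoid G" and r: "monoid_congruence G r"
    and ab: "a \<in> carrier G" "b \<in> carrier G" "(a, b) \<notin> r"
  shows "\<exists>P w. monoid_prime G P \<and> key_witness G r P w \<and> (a, b) \<notin> soccular_component G r P w"
proof -
  obtain q P where q: "q \<in> carrier G" and P: "monoid_prime G P"
    and P_eq: "P = {p \<in> carrier G. (a \<otimes> q \<otimes> p, b \<otimes> q \<otimes> p) \<in> r}"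
    using transporter_prime[OF assms] by blast
  have rsub: "r \<subseteq> carrier G \<times> carrier G"
    using monoid_congruenceD(3)[OF r] by auto
  interpret comm_monoid_localized G P r
    by unfold_locales (fact P rsub)+
  define x y where "x = a \<otimes> q" and "y = b \<otimes> q"
  have xy: "x \<in> carrier G" "y \<in> carrier G"
    unfolding x_def y_def using ab q by auto
  \<comment> \<open>Equal images would give an \<open>s\<close> outside \<open>P\<close> with
    \<open>x \<otimes> s\<close> and \<open>y \<otimes> s\<close> related, but \<open>P_eq\<close>
    puts such an \<open>s\<close> into \<open>P\<close>.\<close>
  have ne: "\<beta> x \<noteq> \<beta> y"
    using local_class_eqD[OF r xy] xy P_eq unfolding x_def y_def by blast
  have eq: "\<beta> x \<otimes>\<^bsub>L\<^esub> \<beta> p = \<beta> y \<otimes>\<^bsub>L\<^esub> \<beta> p" if "p \<in> P" for p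
  proof -
    have "p \<in> carrier G" "(x \<otimes> p, y \<otimes> p) \<in> r"
      using that P_eq unfolding x_def y_def by auto
    then show ?thesis
      using local_class_mult xy local_class_eqI by metis
  qed
  \<comment> \<open>A witness needs an aide that is not strictly below it. The strict Green order
    cannot hold in both directions, so one of the two assignments of roles works.\<close>
  obtain w where w: "w = x \<or> w = y" "key_witness G r P w"
  proof (cases "green_less L (\<beta> y) (\<beta> x)")
    case True
    then have "\<not> green_less L (\<beta> x) (\<beta> y)"
      unfolding green_less_def by blast
    then have "key_aide G r P y x"
      unfolding key_aide_def Let_def using xy ne eq by auto
    then show ?thesis
      using that[of y] xy unfolding key_witness_def by blast
  next
    case False
    then have "key_aide G r P x y"
      unfolding key_aide_def Let_def using xy ne eq by auto
    then show ?thesis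
      using that[of x] xy unfolding key_witness_def by blast
  qed
  have "w \<in> carrier G"
    using w xy by blast
  \<comment> \<open>Were \<open>a\<close> and \<open>b\<close> related, translation by
    \<open>q\<close> would relate \<open>x\<close> and \<open>y\<close>, one of which is
    \<open>w\<close>.\<close>
  then have "(a, b) \<notin> soccular_component G r P w"
    using soccular_component_translate[OF rsub _ q]
      key_witness_not_in_soccular_component[OF rsub w(1) ne] unfolding x_def y_def by blast
  then show ?thesis
    using P w by blast
qed

end

theorem theorem4p5:
  fixes Q :: "('a, 'b) monoid_scheme" and r :: "'a rel"
  assumes "noetherian_comm_monoid Q"
    and "monoid_congruence Q r"
  shows "r = common_refinement Q
               {soccular_component Q r P w | P w. monoid_prime Q P \<and> key_witness Q r P w}"
proof -
  interpret comm_monoid Q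
    using assms(1) unfolding noetherian_comm_monoid_def by blast
  have sub: "r \<subseteq> carrier Q \<times> carrier Q"
    using monoid_congruenceD(3)[OF assms(2)] by auto
  have "r \<subseteq> soccular_component Q r P w" if P: "monoid_prime Q P" and w: "key_witness Q r P w"
    for P w
  proof -
    interpret comm_monoid_localized Q P r
      by unfold_locales (fact P sub)+
    \<comment> \<open>The union defining the closure includes the iterate \<open>0\<close>, which is
      the coprincipal component itself.\<close>
    have "r \<subseteq> (soccular_collapse Q P w ^^ 0) (coprincipal_component Q r P w)"
      using coprincipal_component_contains w unfolding key_witness_def by simp
    then show ?thesis
      unfolding soccular_component_def soccular_closure_def by blast
  qed
  then have "r \<subseteq> common_refinement Q
      {soccular_component Q r P w | P w. monoid_prime Q P \<and> key_witness Q r P w}"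
    using sub unfolding common_refinement_def by auto
  moreover have "(a, b) \<in> r" if "(a, b) \<in> common_refinement Q
      {soccular_component Q r P w | P w. monoid_prime Q P \<and> key_witness Q r P w}" for a b
  proof (rule ccontr)
    assume "(a, b) \<notin> r"
    moreover have "a \<in> carrier Q" "b \<in> carrier Q"
      using that unfolding common_refinement_def by simp_all
    ultimately obtain P w where "monoid_prime Q P" "key_witness Q r P w"
      "(a, b) \<notin> soccular_component Q r P w"
      using separated_by_soccular_component[OF assms] by blast
    then show False
      using that unfolding common_refinement_def by blast
  qed
  ultimately show ?thesis
    by (intro subset_antisym subrelI) auto
qed

end
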